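(* Let $F=\{\zeta_j\}_{j=1}^m$ be a finite subset of $\mathbb{T}=\partial\mathbb{D}$, and let $L_F$ be the restriction of $z\frac{d}{dz}$ to $$\mathscr{D}(L_F)=\{f\in\mathscr{H}_2 : z\tfrac{d}{dz}f\in\mathscr{H}_2,\ \tilde f=0\text{ on }F\}.$$ Set $$(CP_F(g))(z)=\sum_{j=1}^m\Bigl(\lim_{w\to\zeta_j}(w-\zeta_j)g(w)\Bigr)\frac{1}{z-\zeta_j}.$$ Then the adjoint $L_F^*$ acts on its domain $\mathscr{D}(L_F^* )$ as $$L_F^*=(1-CP_F)\,z\frac{d}{dz},$$ i.e. $L_F^*f=z\frac{df}{dz}-CP_F\bigl(z\frac{df}{dz}\bigr)$ for all $f\in\mathscr{D}(L_F^* )$.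
   Context: $\mathbb{D}$ is the open unit disk. $\mathscr{H}_2$ is the Hardy space of analytic functions $f(z)=\sum_{k\ge0}x_kz^k$ on $\mathbb{D}$ with $\|f\|^2=\sum|x_k|^2<\infty$. If $f$ and $z\frac{d}{dz}f$ lie in $\mathscr{H}_2$, the Taylor coefficients of $f$ are absolutely summable and $\tilde f$ denotes the continuous extension of $f$ to $\overline{\mathbb{D}}$. $L_F$ is a densely defined Hermitian operator with deficiency indices $(m,m)$. The points $\zeta_1,\dots,\zeta_m$ are distinct, and limits $w\to\zeta_j$ are non-tangential limits from within $\mathbb{D}$. *)

theory Defs
  imports "HOL-Complex_Analysis.Complex_Analysis" "HOL-Library.FuncSet"
begin

abbreviation unit_disk :: "complex set" where
  "unit_disk \<equiv> ball 0 1"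

definition taylor_coeff :: "(complex \<Rightarrow> complex) \<Rightarrow> nat \<Rightarrow> complex" where
  "taylor_coeff f k = (deriv ^^ k) f 0 / fact k"

text \<open>Elements of the Hardy space are functions on the disk only; requiring them to be extensional
  makes equality in \<open>hardy2\<close> the same as equality on the disk.\<close>

definition hardy2 :: "(complex \<Rightarrow> complex) set" where
  "hardy2 = {f \<in> extensional unit_disk. f holomorphic_on unit_disk \<and>
                summable (\<lambda>k. (cmod (taylor_coeff f k))\<^sup>2)}"

definition hardy2_inner :: "(complex \<Rightarrow> complex) \<Rightarrow> (complex \<Rightarrow> complex) \<Rightarrow> complex" where
  "hardy2_inner f g = (\<Sum>k. taylor_coeff f k * cnj (taylor_coeff g k))"

text \<open>Unbounded operators are given by a domain \<open>D\<close> and a map \<open>T\<close>, of which only the values on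
  \<open>D\<close> matter. The definite description denotes the adjoint's value when \<open>D\<close> is dense.\<close>

definition hardy2_adjoint_domain ::
    "(complex \<Rightarrow> complex) set \<Rightarrow> ((complex \<Rightarrow> complex) \<Rightarrow> complex \<Rightarrow> complex) \<Rightarrow> (complex \<Rightarrow> complex) set" where
  "hardy2_adjoint_domain D T =
     {g \<in> hardy2. \<exists>h\<in>hardy2. \<forall>f\<in>D. hardy2_inner (T f) g = hardy2_inner f h}"

definition hardy2_adjoint ::
    "(complex \<Rightarrow> complex) set \<Rightarrow> ((complex \<Rightarrow> complex) \<Rightarrow> complex \<Rightarrow> complex) \<Rightarrow>
     (complex \<Rightarrow> complex) \<Rightarrow> complex \<Rightarrow> complex" where
  "hardy2_adjoint D T g =
     (THE h. h \<in> hardy2 \<and> (\<forall>f\<in>D. hardy2_inner (T f) g = hardy2_inner f h))"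

definition z_ddz :: "(complex \<Rightarrow> complex) \<Rightarrow> complex \<Rightarrow> complex" where
  "z_ddz f = (\<lambda>z\<in>unit_disk. z * deriv f z)"

definition disk_extension :: "(complex \<Rightarrow> complex) \<Rightarrow> complex \<Rightarrow> complex" where
  "disk_extension f z = (if z \<in> unit_disk then f z else Lim (at z within unit_disk) f)"

definition L_domain :: "complex set \<Rightarrow> (complex \<Rightarrow> complex) set" where
  "L_domain F = {f \<in> hardy2. z_ddz f \<in> hardy2 \<and> (\<forall>\<zeta>\<in>F. disk_extension f \<zeta> = 0)}"

definition L_op :: "complex set \<Rightarrow> (complex \<Rightarrow> complex) \<Rightarrow> complex \<Rightarrow> complex" where
  "L_op F = restrict z_ddz (L_domain F)"

definition stolz_region :: "complex \<Rightarrow> real \<Rightarrow> complex set" where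
  "stolz_region \<zeta> M = {w \<in> unit_disk. cmod (w - \<zeta>) < M * (1 - cmod w)}"

text \<open>Convergence along this filter is convergence within every Stolz region at \<open>\<zeta>\<close>.\<close>

definition nontangential :: "complex \<Rightarrow> complex filter" where
  "nontangential \<zeta> = (SUP M\<in>{1<..}. at \<zeta> within stolz_region \<zeta> M)"

definition CP :: "complex set \<Rightarrow> (complex \<Rightarrow> complex) \<Rightarrow> complex \<Rightarrow> complex" where
  "CP F g z = (\<Sum>\<zeta>\<in>F. Lim (nontangential \<zeta>) (\<lambda>w. (w - \<zeta>) * g w) * (1 / (z - \<zeta>)))"

end

theory Submission imports Defs begin

text \<open>
  Let \<open>h\<close> be a value of the adjoint at \<open>f\<close> and put \<open>a\<^sub>k = k f\<^sub>k - h\<^sub>k\<close>, the Taylor coefficients of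
  \<open>z f' - h\<close>. The adjoint equation says that \<open>\<Sum>\<^sub>k u\<^sub>k cnj a\<^sub>k = 0\<close> for all \<open>u\<close> in the domain of \<open>L\<^sub>F\<close>.
  It already determines \<open>h\<close> when tested on polynomials vanishing on \<open>F\<close>, for which all
  sums are finite. The space of these polynomials has codimension \<open>card F\<close>, and the functionals
  killing it are spanned by the evaluations at the points of \<open>F\<close>
  (\<open>annihilator_of_vanishing_polynomials\<close>). Hence \<open>cnj a\<^sub>k = \<Sum>\<^sub>\<zeta> c\<^sub>\<zeta> \<zeta>\<^sup>k\<close>, and summing geometric series gives
  \<open>z f' = h + \<Sum>\<^sub>\<zeta> b\<^sub>\<zeta> / (z - \<zeta>)\<close> on the disk (\<open>adjoint_value_simple_poles\<close>).

  It remains to recognise the polar part as \<open>CP F (z f')\<close>. A Hardy function grows at most like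
  \<open>(1 - \<bar>w\<bar>)\<close> to the power \<open>-1/2\<close>, while \<open>\<bar>w - \<zeta>\<bar>\<close> is bounded by a multiple of \<open>1 - \<bar>w\<bar>\<close> in a Stolz region;
  so \<open>(w - \<zeta>) h w\<close> tends to \<open>0\<close> nontangentially, and \<open>(w - \<zeta>) z f'\<close> tends to \<open>b\<^sub>\<zeta>\<close>
  (\<open>nontangential_residue\<close>). This expresses every adjoint value through \<open>f\<close> alone, so it also yields the
  uniqueness on which the definite description in \<open>hardy2_adjoint\<close> rests.
\<close>

section \<open>Taylor coefficients of functions on the disk\<close>

lemma holomorphic_taylor_sums:
  assumes "f holomorphic_on unit_disk" "z \<in> unit_disk"
  shows "(\<lambda>k. taylor_coeff f k * z ^ k) sums f z"
  using holomorphic_power_series[OF assms] by (simp add: taylor_coeff_def)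

lemma taylor_coeff_eq_fps_nth:
  assumes "f has_fps_expansion A"
  shows "taylor_coeff f k = fps_nth A k"
  using fps_nth_fps_expansion[OF assms] by (simp add: taylor_coeff_def)

lemma eventually_in_disk: "\<forall>\<^sub>F z in nhds 0. z \<in> unit_disk"
  by (rule eventually_nhds_in_open) auto

lemma taylor_coeff_z_ddz:
  assumes "f holomorphic_on unit_disk"
  shows "taylor_coeff (z_ddz f) k = of_nat k * taylor_coeff f k"
proof -
  let ?A = "fps_expansion f 0"
  have A: "f has_fps_expansion ?A"
    by (rule has_fps_expansion_fps_expansion[OF open_ball _ assms]) simp
  have "(\<lambda>z. z * deriv f z) has_fps_expansion fps_X * fps_deriv ?A"
    by (intro fps_expansion_intros A)
  moreover have ev: "\<forall>\<^sub>F z in nhds 0. z_ddz f z = z * deriv f z"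
    using eventually_in_disk by eventually_elim (simp add: z_ddz_def)
  ultimately have "z_ddz f has_fps_expansion fps_X * fps_deriv ?A"
    using has_fps_expansion_cong[OF ev refl] by simp
  from taylor_coeff_eq_fps_nth[OF this, of k] taylor_coeff_eq_fps_nth[OF A, of k]
  show ?thesis by (cases k) auto
qed

lemma holomorphic_z_ddz:
  assumes "f holomorphic_on unit_disk"
  shows "z_ddz f holomorphic_on unit_disk"
proof -
  have "(\<lambda>z. z * deriv f z) holomorphic_on unit_disk"
    by (intro holomorphic_intros holomorphic_deriv assms) auto
  thus ?thesis by (rule holomorphic_transform) (simp add: z_ddz_def)
qed

lemma z_ddz_in_extensional: "z_ddz f \<in> extensional unit_disk"
  by (simp add: z_ddz_def)

lemma taylor_coeff_poly: "taylor_coeff (restrict (poly p) unit_disk) k = coeff p k"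
proof -
  have "poly p has_fps_expansion fps_of_poly p"
    by (auto simp: has_fps_expansion_def)
  moreover have ev: "\<forall>\<^sub>F z in nhds 0. restrict (poly p) unit_disk z = poly p z"
    using eventually_in_disk by eventually_elim simp
  ultimately have "restrict (poly p) unit_disk has_fps_expansion fps_of_poly p"
    unfolding has_fps_expansion_cong[OF ev refl] by blast
  from taylor_coeff_eq_fps_nth[OF this] show ?thesis by simp
qed

lemma poly_holomorphic_on_disk: "restrict (poly p) unit_disk holomorphic_on unit_disk"
proof -
  have "poly p holomorphic_on unit_disk" by (intro holomorphic_intros)
  thus ?thesis by (rule holomorphic_transform) simp
qed

text \<open>
  Polynomials vanishing on \<open>F\<close> are the test functions for the adjoint: only finitely many of their
  coefficients are nonzero, and their continuity makes the boundary values plain evaluations.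
\<close>

lemma poly_in_L_domain:
  assumes "F \<subseteq> sphere 0 1" "\<And>\<zeta>. \<zeta> \<in> F \<Longrightarrow> poly p \<zeta> = 0"
  shows "restrict (poly p) unit_disk \<in> L_domain F"
proof -
  let ?u = "restrict (poly p) unit_disk"
  have 1: "?u \<in> hardy2"
    unfolding hardy2_def using poly_holomorphic_on_disk
    by (auto simp: taylor_coeff_poly le_degree intro!: summable_finite[of "{..degree p}"])
  have 2: "z_ddz ?u \<in> hardy2"
    unfolding hardy2_def using holomorphic_z_ddz[OF poly_holomorphic_on_disk]
    by (auto simp: taylor_coeff_z_ddz[OF poly_holomorphic_on_disk] z_ddz_in_extensional
        taylor_coeff_poly le_degree intro!: summable_finite[of "{..degree p}"])
  have 3: "disk_extension ?u \<zeta> = 0" if "\<zeta> \<in> F" for \<zeta>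
  proof -
    have n: "norm \<zeta> = 1" using assms that by auto
    have "\<zeta> islimpt unit_disk" by (simp add: islimpt_ball n)
    hence nt: "at \<zeta> within unit_disk \<noteq> bot" by (simp add: trivial_limit_within)
    have "(poly p \<longlongrightarrow> poly p \<zeta>) (at \<zeta> within unit_disk)"
      by (intro tendsto_intros)
    hence "(?u \<longlongrightarrow> 0) (at \<zeta> within unit_disk)"
      using assms(2)[OF that]
      by (metis (mono_tags, lifting) Lim_cong_within restrict_apply')
    hence "Lim (at \<zeta> within unit_disk) ?u = 0" using tendsto_Lim[OF nt] by blast
    thus ?thesis by (simp add: disk_extension_def n)
  qed
  show ?thesis unfolding L_domain_def using 1 2 3 by auto
qed

section \<open>Functionals annihilating the polynomials that vanish on a finite set\<close>

lemma exists_lagrange_basis: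
  fixes F :: "'a::field set"
  assumes "finite F"
  shows "\<exists>l :: 'a \<Rightarrow> 'a poly. \<forall>\<zeta>\<in>F. \<forall>\<eta>\<in>F. poly (l \<zeta>) \<eta> = (if \<zeta> = \<eta> then 1 else 0)"
proof -
  define l :: "'a \<Rightarrow> 'a poly"
    where "l = (\<lambda>\<zeta>. \<Prod>\<xi>\<in>F - {\<zeta>}. smult (1 / (\<zeta> - \<xi>)) [:-\<xi>, 1:])"
  have "poly (l \<zeta>) \<eta> = (if \<zeta> = \<eta> then 1 else 0)" if "\<zeta> \<in> F" "\<eta> \<in> F" for \<zeta> \<eta>
  proof -
    have "poly (l \<zeta>) \<eta> = (\<Prod>\<xi>\<in>F - {\<zeta>}. (\<eta> - \<xi>) / (\<zeta> - \<xi>))"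
      unfolding l_def poly_prod by (intro prod.cong) (auto simp: diff_divide_distrib)
    also have "\<dots> = (if \<zeta> = \<eta> then 1 else 0)"
      using assms that by (auto intro!: prod.neutral prod_zero)
    finally show ?thesis .
  qed
  thus ?thesis by blast
qed

text \<open>
  Subtracting from \<open>z\<^sup>k\<close> its Lagrange interpolant \<open>\<Sum>\<^sub>\<zeta> \<zeta>\<^sup>k l\<^sub>\<zeta>\<close> leaves a polynomial vanishing on \<open>F\<close>. Applying
  the functional \<open>p \<mapsto> \<Sum>\<^sub>i p\<^sub>i b\<^sub>i\<close> to it gives the claim, with \<open>c\<^sub>\<zeta>\<close> the value of the functional at \<open>l\<^sub>\<zeta>\<close>.
  The bound \<open>N\<close> in the hypothesis lets polynomials of different degrees be summed over a common range.
\<close>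

lemma annihilator_of_vanishing_polynomials:
  fixes F :: "'a::field set" and b :: "nat \<Rightarrow> 'a"
  assumes fin: "finite F"
    and ann: "\<And>p N. \<lbrakk>\<And>\<zeta>. \<zeta> \<in> F \<Longrightarrow> poly p \<zeta> = 0; degree p < N\<rbrakk> \<Longrightarrow>
              (\<Sum>i<N. coeff p i * b i) = 0"
  obtains c where "\<And>k. b k = (\<Sum>\<zeta>\<in>F. c \<zeta> * \<zeta> ^ k)"
proof -
  obtain l where l: "\<And>\<zeta> \<eta>. \<zeta> \<in> F \<Longrightarrow> \<eta> \<in> F \<Longrightarrow> poly (l \<zeta>) \<eta> = (if \<zeta> = \<eta> then 1 else 0)"
    using exists_lagrange_basis[OF fin] by blast
  define c where "c = (\<lambda>\<zeta>. \<Sum>i\<le>degree (l \<zeta>). coeff (l \<zeta>) i * b i)"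
  have "b k = (\<Sum>\<zeta>\<in>F. c \<zeta> * \<zeta> ^ k)" for k
  proof -
    define p where "p = monom 1 k - (\<Sum>\<zeta>\<in>F. smult (\<zeta> ^ k) (l \<zeta>))"
    define N where "N = Suc (k + degree p + (\<Sum>\<zeta>\<in>F. degree (l \<zeta>)))"
    have N: "k < N" "degree p < N" "\<And>\<zeta>. \<zeta> \<in> F \<Longrightarrow> degree (l \<zeta>) < N"
      using fin by (auto simp: N_def less_Suc_eq_le intro: trans_le_add2 member_le_sum)
    have c: "(\<Sum>i<N. coeff (l \<zeta>) i * b i) = c \<zeta>" if "\<zeta> \<in> F" for \<zeta>
      unfolding c_def using N(3)[OF that]
      by (intro sum.mono_neutral_right) (auto simp: coeff_eq_0 not_le)
    have "poly p \<eta> = 0" if "\<eta> \<in> F" for \<eta>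
    proof -
      have "(\<Sum>\<zeta>\<in>F. \<zeta> ^ k * poly (l \<zeta>) \<eta>) = (\<Sum>\<zeta>\<in>F. if \<zeta> = \<eta> then \<eta> ^ k else 0)"
        using l that by (intro sum.cong) auto
      thus ?thesis using fin that by (simp add: p_def poly_monom poly_sum)
    qed
    from ann[OF this N(2)]
    have "0 = (\<Sum>i<N. coeff p i * b i)" by simp
    also have "\<dots> = (\<Sum>i<N. (if i = k then b i else 0))
                     - (\<Sum>i<N. \<Sum>\<zeta>\<in>F. \<zeta> ^ k * (coeff (l \<zeta>) i * b i))"
      unfolding sum_subtractf[symmetric]
      by (intro sum.cong) (auto simp: p_def coeff_sum left_diff_distrib sum_distrib_right mult.assoc)
    also have "(\<Sum>i<N. \<Sum>\<zeta>\<in>F. \<zeta> ^ k * (coeff (l \<zeta>) i * b i))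
                 = (\<Sum>\<zeta>\<in>F. \<zeta> ^ k * (\<Sum>i<N. coeff (l \<zeta>) i * b i))"
      by (subst sum.swap) (simp add: sum_distrib_left)
    also have "(\<Sum>\<zeta>\<in>F. \<zeta> ^ k * (\<Sum>i<N. coeff (l \<zeta>) i * b i)) = (\<Sum>\<zeta>\<in>F. c \<zeta> * \<zeta> ^ k)"
      by (intro sum.cong) (simp_all only: c mult.commute[of "c _"])
    finally show ?thesis using N(1) by simp
  qed
  thus ?thesis by (rule that)
qed

section \<open>Boundary growth of Hardy functions\<close>

text \<open>
  The bound \<open>\<bar>h w\<bar> \<le> C / sqrt (1 - \<bar>w\<bar>)\<close>, multiplied by \<open>1 - \<bar>w\<bar>\<close>. With \<open>r = \<bar>w\<bar>\<close> and \<open>s = sqrt (1 - r)\<close>, each term of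
  the Taylor series satisfies \<open>\<bar>a\<^sub>k\<bar> r\<^sup>k \<le> \<bar>a\<^sub>k\<bar>\<^sup>2 / s + s r\<^sup>k\<close> by the inequality between arithmetic and
  geometric means and \<open>r\<^sup>2\<^sup>k \<le> r\<^sup>k\<close>; the weight \<open>s\<close> makes both resulting sums of order \<open>1 / s\<close>.
\<close>

lemma hardy2_growth:
  assumes "h \<in> hardy2"
  obtains C where "\<And>w. w \<in> unit_disk \<Longrightarrow> (1 - cmod w) * cmod (h w) \<le> C * sqrt (1 - cmod w)"
proof -
  define a where "a = taylor_coeff h"
  define S where "S = (\<Sum>k. (cmod (a k))\<^sup>2)"
  have sm: "summable (\<lambda>k. (cmod (a k))\<^sup>2)" and hol: "h holomorphic_on unit_disk"
    using assms by (auto simp: hardy2_def a_def)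
  have "(1 - cmod w) * cmod (h w) \<le> (S + 1) * sqrt (1 - cmod w)" if w: "w \<in> unit_disk" for w
  proof -
    define r where "r = cmod w"
    define s where "s = sqrt (1 - r)"
    have r: "0 \<le> r" "r < 1" using w by (auto simp: r_def)
    have s: "s > 0" "s\<^sup>2 = 1 - r" using r by (auto simp: s_def)
    have geo: "(\<lambda>k. s * r ^ k) sums (s * (1 / (1 - r)))"
      using r by (intro sums_mult geometric_sums) auto
    have sq: "(\<lambda>k. (1 / s) * (cmod (a k))\<^sup>2) sums ((1 / s) * S)"
      unfolding S_def by (intro sums_mult summable_sums sm)
    have bd: "(\<lambda>k. (1 / s) * (cmod (a k))\<^sup>2 + s * r ^ k) sums ((1 / s) * S + s * (1 / (1 - r)))"
      by (rule sums_add[OF sq geo])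
    have le: "cmod (a k * w ^ k) \<le> (1 / s) * (cmod (a k))\<^sup>2 + s * r ^ k" for k
    proof -
      let ?x = "cmod (a k)" and ?y = "r ^ k"
      have y: "0 \<le> ?y" "?y \<le> 1" using r by (auto simp: power_le_one)
      have "?y\<^sup>2 \<le> ?y" using y by (simp add: power2_eq_square mult_left_le)
      hence 1: "s\<^sup>2 * ?y\<^sup>2 \<le> s\<^sup>2 * ?y" by (intro mult_left_mono) auto
      have "0 \<le> (?x - s * ?y)\<^sup>2" by simp
      hence "2 * (s * (?x * ?y)) \<le> ?x\<^sup>2 + s\<^sup>2 * ?y"
        using 1 by (simp add: power2_diff power_mult_distrib algebra_simps)
      moreover have "0 \<le> s * (?x * ?y)" using s y by simp
      ultimately have "s * (?x * ?y) \<le> ?x\<^sup>2 + s\<^sup>2 * ?y" by linarith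
      thus ?thesis using s(1)
        by (simp add: norm_mult norm_power r_def field_simps power2_eq_square)
    qed
    have hs: "(\<lambda>k. a k * w ^ k) sums h w"
      unfolding a_def by (rule holomorphic_taylor_sums[OF hol w])
    have "cmod (h w) \<le> (1 / s) * S + s * (1 / (1 - r))"
      using norm_suminf_le[OF le sums_summable[OF bd]]
        sums_unique[OF hs] sums_unique[OF bd] by simp
    hence "s\<^sup>2 * cmod (h w) \<le> s\<^sup>2 * ((1 / s) * S + s * (1 / s\<^sup>2))"
      unfolding s(2) using r by (intro mult_left_mono) auto
    also have "\<dots> = (S + 1) * s" using s(1) by (simp add: field_simps power2_eq_square)
    finally show ?thesis unfolding s(2) by (simp add: s_def r_def)
  qed
  thus ?thesis by (rule that)
qed

section \<open>Nontangential limits\<close>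

lemma tendsto_nontangential_iff:
  "(g \<longlongrightarrow> l) (nontangential \<zeta>) \<longleftrightarrow> (\<forall>M>1. (g \<longlongrightarrow> l) (at \<zeta> within stolz_region \<zeta> M))"
  by (auto simp: nontangential_def filterlim_def filtermap_SUP SUP_le_iff)

text \<open>
  Nontangential limits at a boundary point are unique because the radius ends there inside a Stolz region.
\<close>

lemma nontangential_neq_bot:
  assumes "cmod \<zeta> = 1"
  shows "nontangential \<zeta> \<noteq> bot"
proof -
  have "\<zeta> islimpt stolz_region \<zeta> 2"
    unfolding islimpt_approachable
  proof (intro allI impI)
    fix e :: real assume e: "e > 0"
    define t where "t = 1 - min (1/2) (e / 2)"
    have t: "0 < t" "t < 1" "1 - t < e" using e by (auto simp: t_def min_def)
    have "of_real t * \<zeta> - \<zeta> = of_real (t - 1) * \<zeta>" by (simp add: algebra_simps)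
    hence d: "cmod (of_real t * \<zeta> - \<zeta>) = 1 - t"
      using t assms by (simp only: norm_mult norm_of_real) simp
    show "\<exists>x'\<in>stolz_region \<zeta> 2. x' \<noteq> \<zeta> \<and> dist x' \<zeta> < e"
    proof (intro bexI conjI)
      show "of_real t * \<zeta> \<noteq> \<zeta>" using d t by auto
      show "dist (of_real t * \<zeta>) \<zeta> < e" using d t by (simp add: dist_norm)
      show "of_real t * \<zeta> \<in> stolz_region \<zeta> 2"
        using t d assms by (simp add: stolz_region_def norm_mult)
    qed
  qed
  hence "at \<zeta> within stolz_region \<zeta> 2 \<noteq> bot" by (simp add: trivial_limit_within)
  moreover have "at \<zeta> within stolz_region \<zeta> 2 \<le> nontangential \<zeta>"
    unfolding nontangential_def by (rule SUP_upper) auto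
  ultimately show ?thesis by (auto simp: le_bot)
qed

lemma nontangential_hardy2_null:
  assumes "h \<in> hardy2" "cmod \<zeta> = 1"
  shows "((\<lambda>w. (w - \<zeta>) * h w) \<longlongrightarrow> 0) (nontangential \<zeta>)"
  unfolding tendsto_nontangential_iff
proof (intro allI impI)
  fix M :: real assume M: "M > 1"
  obtain C where C: "\<And>w. w \<in> unit_disk \<Longrightarrow> (1 - cmod w) * cmod (h w) \<le> C * sqrt (1 - cmod w)"
    using hardy2_growth[OF assms(1)] by blast
  let ?A = "at \<zeta> within stolz_region \<zeta> M"
  have "((\<lambda>w. M * (C * sqrt (1 - cmod w))) \<longlongrightarrow> M * (C * sqrt (1 - cmod \<zeta>))) ?A"
    by (intro tendsto_intros)
  hence lim: "((\<lambda>w. M * (C * sqrt (1 - cmod w))) \<longlongrightarrow> 0) ?A" using assms by simp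
  have "\<forall>\<^sub>F w in ?A. cmod ((w - \<zeta>) * h w) \<le> M * (C * sqrt (1 - cmod w))"
    unfolding eventually_at_filter
  proof (intro always_eventually allI impI)
    fix w assume "w \<in> stolz_region \<zeta> M"
    hence w: "w \<in> unit_disk" "cmod (w - \<zeta>) \<le> M * (1 - cmod w)"
      by (auto simp: stolz_region_def)
    have "cmod (w - \<zeta>) * cmod (h w) \<le> (M * (1 - cmod w)) * cmod (h w)"
      using w(2) by (intro mult_right_mono) auto
    also have "\<dots> = M * ((1 - cmod w) * cmod (h w))" by simp
    also have "\<dots> \<le> M * (C * sqrt (1 - cmod w))"
      using C[OF w(1)] M by (intro mult_left_mono) auto
    finally show "cmod ((w - \<zeta>) * h w) \<le> M * (C * sqrt (1 - cmod w))"
      by (simp add: norm_mult)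
  qed
  thus "((\<lambda>w. (w - \<zeta>) * h w) \<longlongrightarrow> 0) ?A" by (rule Lim_null_comparison) (rule lim)
qed

lemma nontangential_residue:
  assumes fin: "finite F" and "h \<in> hardy2" "cmod \<zeta> = 1" "\<zeta> \<in> F"
    and g: "\<And>w. w \<in> unit_disk \<Longrightarrow> g w = h w + (\<Sum>\<eta>\<in>F. b \<eta> / (w - \<eta>))"
  shows "((\<lambda>w. (w - \<zeta>) * g w) \<longlongrightarrow> b \<zeta>) (nontangential \<zeta>)"
  unfolding tendsto_nontangential_iff
proof (intro allI impI)
  fix M :: real assume M: "M > 1"
  let ?A = "at \<zeta> within stolz_region \<zeta> M"
  let ?R = "\<lambda>w. \<Sum>\<eta>\<in>F - {\<zeta>}. b \<eta> / (w - \<eta>)"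
  have h: "((\<lambda>w. (w - \<zeta>) * h w) \<longlongrightarrow> 0) ?A"
    using nontangential_hardy2_null[OF assms(2,3)] M by (auto simp: tendsto_nontangential_iff)
  have R: "((\<lambda>w. (w - \<zeta>) * ?R w) \<longlongrightarrow> (\<zeta> - \<zeta>) * ?R \<zeta>) ?A"
    by (intro tendsto_intros) auto
  have "((\<lambda>w. b \<zeta> + (w - \<zeta>) * h w + (w - \<zeta>) * ?R w) \<longlongrightarrow> b \<zeta> + 0 + (\<zeta> - \<zeta>) * ?R \<zeta>) ?A"
    by (intro tendsto_add h R tendsto_const)
  moreover have "\<forall>\<^sub>F w in ?A. b \<zeta> + (w - \<zeta>) * h w + (w - \<zeta>) * ?R w = (w - \<zeta>) * g w"
    unfolding eventually_at_filter
  proof (intro always_eventually allI impI)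
    fix w assume "w \<noteq> \<zeta>" "w \<in> stolz_region \<zeta> M"
    hence w: "w \<in> unit_disk" "w - \<zeta> \<noteq> 0" by (auto simp: stolz_region_def)
    show "b \<zeta> + (w - \<zeta>) * h w + (w - \<zeta>) * ?R w = (w - \<zeta>) * g w"
      unfolding g[OF w(1)] sum.remove[OF fin assms(4)] using w(2)
      by (simp add: distrib_left)
  qed
  ultimately show "((\<lambda>w. (w - \<zeta>) * g w) \<longlongrightarrow> b \<zeta>) ?A"
    by (auto intro: Lim_transform_eventually)
qed

section \<open>The adjoint\<close>

text \<open>
  The sequence \<open>cnj (k f\<^sub>k - h\<^sub>k)\<close> annihilates the polynomials vanishing on \<open>F\<close>, so it is a combination of
  the sequences \<open>\<zeta>\<^sup>k\<close>. After conjugation, each generates the series \<open>1 / (1 - cnj \<zeta> z)\<close>, which is \<open>- \<zeta> / (z - \<zeta>)\<close>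
  because \<open>\<zeta>\<close> lies on the unit circle.
\<close>

lemma adjoint_value_simple_poles:
  assumes fin: "finite F" and F: "F \<subseteq> sphere 0 1"
    and f: "f \<in> hardy2" and h: "h \<in> hardy2"
    and adj: "\<And>u. u \<in> L_domain F \<Longrightarrow> hardy2_inner (L_op F u) f = hardy2_inner u h"
  obtains b where "\<And>w. w \<in> unit_disk \<Longrightarrow> z_ddz f w = h w + (\<Sum>\<eta>\<in>F. b \<eta> / (w - \<eta>))"
proof -
  have holf: "f holomorphic_on unit_disk" and holh: "h holomorphic_on unit_disk"
    using f h by (auto simp: hardy2_def)
  define a where "a = (\<lambda>k. of_nat k * taylor_coeff f k - taylor_coeff h k)"
  have ann: "(\<Sum>i<N. coeff p i * cnj (a i)) = 0"
    if p: "\<And>\<zeta>. \<zeta> \<in> F \<Longrightarrow> poly p \<zeta> = 0" and N: "degree p < N" for p N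
  proof -
    let ?u = "restrict (poly p) unit_disk"
    have u: "?u \<in> L_domain F" by (rule poly_in_L_domain[OF F p])
    have "hardy2_inner (L_op F ?u) f = hardy2_inner (z_ddz ?u) f"
      using u by (simp add: L_op_def)
    also have "\<dots> = (\<Sum>i<N. of_nat i * coeff p i * cnj (taylor_coeff f i))"
      unfolding hardy2_inner_def using N
      by (subst suminf_finite[of "{..<N}"])
         (auto simp: taylor_coeff_z_ddz[OF poly_holomorphic_on_disk] taylor_coeff_poly coeff_eq_0)
    finally have 1: "hardy2_inner (L_op F ?u) f
      = (\<Sum>i<N. of_nat i * coeff p i * cnj (taylor_coeff f i))" .
    have 2: "hardy2_inner ?u h = (\<Sum>i<N. coeff p i * cnj (taylor_coeff h i))"
      unfolding hardy2_inner_def using N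
      by (subst suminf_finite[of "{..<N}"]) (auto simp: taylor_coeff_poly coeff_eq_0)
    show ?thesis using adj[OF u] unfolding 1 2 a_def
      by (simp add: right_diff_distrib sum_subtractf mult_ac)
  qed
  obtain c where c: "\<And>k. cnj (a k) = (\<Sum>\<zeta>\<in>F. c \<zeta> * \<zeta> ^ k)"
    using annihilator_of_vanishing_polynomials[OF fin ann] by blast
  have a: "a k = (\<Sum>\<zeta>\<in>F. cnj (c \<zeta>) * cnj \<zeta> ^ k)" for k
  proof -
    have "a k = cnj (cnj (a k))" by simp
    also have "\<dots> = (\<Sum>\<zeta>\<in>F. cnj (c \<zeta>) * cnj \<zeta> ^ k)" unfolding c by simp
    finally show ?thesis .
  qed
  have "z_ddz f w = h w + (\<Sum>\<eta>\<in>F. (- cnj (c \<eta>) * \<eta>) / (w - \<eta>))" if w: "w \<in> unit_disk" for w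
  proof -
    have "(\<lambda>k. taylor_coeff (z_ddz f) k * w ^ k - taylor_coeff h k * w ^ k) sums (z_ddz f w - h w)"
      by (intro sums_diff holomorphic_taylor_sums holomorphic_z_ddz holf holh w)
    hence 1: "(\<lambda>k. a k * w ^ k) sums (z_ddz f w - h w)"
      by (simp add: taylor_coeff_z_ddz[OF holf] a_def left_diff_distrib)
    have "(\<lambda>k. \<Sum>\<zeta>\<in>F. cnj (c \<zeta>) * (cnj \<zeta> * w) ^ k)
            sums (\<Sum>\<zeta>\<in>F. cnj (c \<zeta>) * (1 / (1 - cnj \<zeta> * w)))"
    proof (intro sums_sum sums_mult geometric_sums)
      fix \<zeta> assume "\<zeta> \<in> F"
      hence "cmod \<zeta> = 1" using F by auto
      thus "norm (cnj \<zeta> * w) < 1" using w by (simp add: norm_mult)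
    qed
    hence "(\<lambda>k. a k * w ^ k) sums (\<Sum>\<zeta>\<in>F. cnj (c \<zeta>) * (1 / (1 - cnj \<zeta> * w)))"
      by (simp add: a sum_distrib_right power_mult_distrib mult.assoc)
    hence "z_ddz f w - h w = (\<Sum>\<zeta>\<in>F. cnj (c \<zeta>) * (1 / (1 - cnj \<zeta> * w)))"
      using 1 sums_unique2 by blast
    also have "\<dots> = (\<Sum>\<zeta>\<in>F. (- cnj (c \<zeta>) * \<zeta>) / (w - \<zeta>))"
    proof (intro sum.cong refl)
      fix \<zeta> assume "\<zeta> \<in> F"
      hence n: "cmod \<zeta> = 1" using F by auto
      hence z: "\<zeta> * cnj \<zeta> = 1" using complex_norm_square[of \<zeta>] by simp
      have ne: "w - \<zeta> \<noteq> 0" "\<zeta> \<noteq> 0" using n w by auto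
      have e: "\<zeta> * (1 - cnj \<zeta> * w) = - (w - \<zeta>)"
        using z by (simp add: right_diff_distrib mult.assoc[symmetric])
      have "1 / (1 - cnj \<zeta> * w) = \<zeta> / (\<zeta> * (1 - cnj \<zeta> * w))" using ne by simp
      also have "\<dots> = - \<zeta> / (w - \<zeta>)" unfolding e by (metis divide_minus_left divide_minus_right)
      finally show "cnj (c \<zeta>) * (1 / (1 - cnj \<zeta> * w)) = (- cnj (c \<zeta>) * \<zeta>) / (w - \<zeta>)" by simp
    qed
    finally show ?thesis by (simp add: algebra_simps)
  qed
  thus ?thesis by (rule that)
qed

text \<open>
  Nontangential limits single out the coefficients of the polar part, so the formula holds for
  any \<open>h\<close> solving the adjoint equation; two solutions therefore coincide.
\<close>

lemma adjoint_value_eq: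
  assumes fin: "finite F" and F: "F \<subseteq> sphere 0 1"
    and f: "f \<in> hardy2" and h: "h \<in> hardy2"
    and adj: "\<And>u. u \<in> L_domain F \<Longrightarrow> hardy2_inner (L_op F u) f = hardy2_inner u h"
  shows "\<forall>\<zeta>\<in>F. \<exists>l. ((\<lambda>w. (w - \<zeta>) * z_ddz f w) \<longlongrightarrow> l) (nontangential \<zeta>)"
    and "h = (\<lambda>z\<in>unit_disk. z_ddz f z - CP F (z_ddz f) z)"
proof -
  obtain b where b: "\<And>w. w \<in> unit_disk \<Longrightarrow> z_ddz f w = h w + (\<Sum>\<eta>\<in>F. b \<eta> / (w - \<eta>))"
    using adjoint_value_simple_poles[OF fin F f h adj] by blast
  have lim: "((\<lambda>w. (w - \<zeta>) * z_ddz f w) \<longlongrightarrow> b \<zeta>) (nontangential \<zeta>)" if "\<zeta> \<in> F" for \<zeta>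
    using F that by (intro nontangential_residue[OF fin h _ that b]) auto
  thus "\<forall>\<zeta>\<in>F. \<exists>l. ((\<lambda>w. (w - \<zeta>) * z_ddz f w) \<longlongrightarrow> l) (nontangential \<zeta>)" by blast
  have Lim: "Lim (nontangential \<zeta>) (\<lambda>w. (w - \<zeta>) * z_ddz f w) = b \<zeta>" if "\<zeta> \<in> F" for \<zeta>
    using F that by (intro tendsto_Lim nontangential_neq_bot lim) auto
  have "CP F (z_ddz f) z = (\<Sum>\<eta>\<in>F. b \<eta> / (z - \<eta>))" for z
    by (simp add: CP_def Lim)
  hence "h z = z_ddz f z - CP F (z_ddz f) z" if "z \<in> unit_disk" for z
    using b[OF that] by simp
  moreover have "h \<in> extensional unit_disk" using h by (simp add: hardy2_def)
  ultimately show "h = (\<lambda>z\<in>unit_disk. z_ddz f z - CP F (z_ddz f) z)"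
    by (intro extensionalityI[of _ unit_disk]) auto
qed

theorem theorem6p31:
  fixes F :: "complex set" and f :: "complex \<Rightarrow> complex"
  assumes "finite F" and "F \<subseteq> sphere 0 1"
    and "f \<in> hardy2_adjoint_domain (L_domain F) (L_op F)"
  shows "(\<forall>\<zeta>\<in>F. \<exists>l. ((\<lambda>w. (w - \<zeta>) * z_ddz f w) \<longlongrightarrow> l) (nontangential \<zeta>)) \<and>
         hardy2_adjoint (L_domain F) (L_op F) f = (\<lambda>z\<in>unit_disk. z_ddz f z - CP F (z_ddz f) z)"
proof -
  obtain h where f: "f \<in> hardy2" and h: "h \<in> hardy2"
    and adj: "\<And>u. u \<in> L_domain F \<Longrightarrow> hardy2_inner (L_op F u) f = hardy2_inner u h"
    using assms(3) by (auto simp: hardy2_adjoint_domain_def)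
  note val = adjoint_value_eq[OF assms(1,2) f]
  have "hardy2_adjoint (L_domain F) (L_op F) f = h"
    unfolding hardy2_adjoint_def
  proof (rule the_equality)
    fix k assume "k \<in> hardy2 \<and>
      (\<forall>u\<in>L_domain F. hardy2_inner (L_op F u) f = hardy2_inner u k)"
    thus "k = h" using val(2)[of k] val(2)[OF h adj] by simp
  qed (use h adj in auto)
  thus ?thesis using val(1)[OF h adj] val(2)[OF h adj] by simp
qed

end
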